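(* Let $(T,\mu,\eta)$ be a monad on a category $\mathsf{C}$ with $\mathcal{K}l(T)$ order enriched, and assume: (a) the inclusion $\mathsf{C}^*_{T,\le}\to\mathsf{C}_{T,\le}$ has a left adjoint $(-)^*$; (b) $(-)^*$ sends homomorphisms to homomorphisms, i.e. restricts to a functor $\mathsf{C}_T\to\mathsf{C}^*_T$; (c) $(-)^*$ is the identity on morphisms (so it sends a coalgebra $\alpha$ on $X$ to a coalgebra $\alpha^*$ on $X$ and each morphism $f$ to $f$). Assume $\mathsf{C}_T$ has a final object $\zeta:Z\to TZ$, write $\mathsf{beh}_\alpha$ for the unique homomorphism from $\alpha$ to $\zeta$, and put $\mathsf{wbeh}_\alpha:=\mathsf{beh}_{\alpha^*}$. Then for every $\alpha:X\to TX$, $\mathsf{wbeh}_\alpha=\mathsf{beh}_{\alpha^*}=\mathsf{beh}_{\zeta^*}\circ\mathsf{beh}_\alpha=\mathsf{wbeh}_\zeta\circ\mathsf{beh}_\alpha$.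
   Context: $\mathcal{K}l(T)$: morphisms $X\rightsquigarrow Y$ are morphisms $X\to TY$, composition $g\cdot f=\mu_Z\circ Tg\circ f$, identity $1_X=\eta_X$; order enriched means hom-sets are posets and composition is monotone. $\mathsf{C}_T$: $T$-coalgebras $\alpha:X\to TX$ with homomorphisms $f$ satisfying $Tf\circ\alpha=\beta\circ f$. $\mathsf{C}_{T,\le}$: $T$-coalgebras with lax homomorphisms $f:X\to Y$, i.e. $Tf\circ\alpha\le\beta\circ f$ in the order of $\mathcal{K}l(T)$. $\mathsf{C}^*_{T,\le}$: full subcategory of $\mathsf{C}_{T,\le}$ on coalgebras with $1_X\le\alpha$ and $\alpha\cdot\alpha\le\alpha$. $\mathsf{C}^*_T$: same objects as $\mathsf{C}^*_{T,\le}$, with homomorphisms of $\mathsf{C}_T$. *)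

theory Defs
  imports Main
begin

section \<open>Categories, functors, adjunctions\<close>

text \<open>
  Hom-sets are families indexed by pairs of objects and need not be disjoint. Composition and the
  action of a functor on morphisms therefore carry the objects as arguments:
  \<open>Comp C X Y Z g f\<close> is the composite of \<open>f : X \<rightarrow> Y\<close> and \<open>g : Y \<rightarrow> Z\<close>. This
  way a (lax) homomorphism of coalgebras is literally a morphism of the base category.
\<close>

record ('o, 'm) cat =
  Obj :: "'o set"
  Hom :: "'o \<Rightarrow> 'o \<Rightarrow> 'm set"
  Comp :: "'o \<Rightarrow> 'o \<Rightarrow> 'o \<Rightarrow> 'm \<Rightarrow> 'm \<Rightarrow> 'm"
  Ident :: "'o \<Rightarrow> 'm"

locale category =
  fixes C :: "('o, 'm) cat"
  assumes Ident_in_Hom: "X \<in> Obj C \<Longrightarrow> Ident C X \<in> Hom C X X"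
    and Comp_in_Hom: "\<lbrakk>X \<in> Obj C; Y \<in> Obj C; Z \<in> Obj C; f \<in> Hom C X Y; g \<in> Hom C Y Z\<rbrakk>
      \<Longrightarrow> Comp C X Y Z g f \<in> Hom C X Z"
    and Comp_Ident_left: "\<lbrakk>X \<in> Obj C; Y \<in> Obj C; f \<in> Hom C X Y\<rbrakk>
      \<Longrightarrow> Comp C X Y Y (Ident C Y) f = f"
    and Comp_Ident_right: "\<lbrakk>X \<in> Obj C; Y \<in> Obj C; f \<in> Hom C X Y\<rbrakk>
      \<Longrightarrow> Comp C X X Y f (Ident C X) = f"
    and Comp_assoc: "\<lbrakk>W \<in> Obj C; X \<in> Obj C; Y \<in> Obj C; Z \<in> Obj C;
        f \<in> Hom C W X; g \<in> Hom C X Y; h \<in> Hom C Y Z\<rbrakk>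
      \<Longrightarrow> Comp C W Y Z h (Comp C W X Y g f) = Comp C W X Z (Comp C X Y Z h g) f"

record ('o, 'm, 'p, 'n) functor_data =
  ObMap :: "'o \<Rightarrow> 'p"
  ArMap :: "'o \<Rightarrow> 'o \<Rightarrow> 'm \<Rightarrow> 'n"

locale is_functor = dom: category C + cod: category D
  for C :: "('o, 'm) cat" and D :: "('p, 'n) cat" +
  fixes F :: "('o, 'm, 'p, 'n) functor_data"
  assumes ObMap_in_Obj: "X \<in> Obj C \<Longrightarrow> ObMap F X \<in> Obj D"
    and ArMap_in_Hom: "\<lbrakk>X \<in> Obj C; Y \<in> Obj C; f \<in> Hom C X Y\<rbrakk>
      \<Longrightarrow> ArMap F X Y f \<in> Hom D (ObMap F X) (ObMap F Y)"
    and ArMap_Ident: "X \<in> Obj C \<Longrightarrow> ArMap F X X (Ident C X) = Ident D (ObMap F X)"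
    and ArMap_Comp: "\<lbrakk>X \<in> Obj C; Y \<in> Obj C; Z \<in> Obj C; f \<in> Hom C X Y; g \<in> Hom C Y Z\<rbrakk>
      \<Longrightarrow> ArMap F X Z (Comp C X Y Z g f)
        = Comp D (ObMap F X) (ObMap F Y) (ObMap F Z) (ArMap F Y Z g) (ArMap F X Y f)"

definition id_functor :: "('o, 'm, 'o, 'm) functor_data" where
  "id_functor = \<lparr>ObMap = (\<lambda>X. X), ArMap = (\<lambda>X Y f. f)\<rparr>"

definition comp_functor ::
  "('p, 'n, 'q, 'k) functor_data \<Rightarrow> ('o, 'm, 'p, 'n) functor_data \<Rightarrow> ('o, 'm, 'q, 'k) functor_data"
  where
  "comp_functor G F = \<lparr>ObMap = (\<lambda>X. ObMap G (ObMap F X)),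
     ArMap = (\<lambda>X Y f. ArMap G (ObMap F X) (ObMap F Y) (ArMap F X Y f))\<rparr>"

locale natural_transformation = F: is_functor C D F + G: is_functor C D G
  for C :: "('o, 'm) cat" and D :: "('p, 'n) cat"
    and F :: "('o, 'm, 'p, 'n) functor_data" and G :: "('o, 'm, 'p, 'n) functor_data" +
  fixes t :: "'o \<Rightarrow> 'n"
  assumes component_in_Hom: "X \<in> Obj C \<Longrightarrow> t X \<in> Hom D (ObMap F X) (ObMap G X)"
    and naturality: "\<lbrakk>X \<in> Obj C; Y \<in> Obj C; f \<in> Hom C X Y\<rbrakk>
      \<Longrightarrow> Comp D (ObMap F X) (ObMap F Y) (ObMap G Y) (t Y) (ArMap F X Y f)
        = Comp D (ObMap F X) (ObMap G X) (ObMap G Y) (ArMap G X Y f) (t X)"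

definition left_adjoint ::
  "('o, 'm) cat \<Rightarrow> ('p, 'n) cat \<Rightarrow> ('o, 'm, 'p, 'n) functor_data \<Rightarrow> ('p, 'n, 'o, 'm) functor_data
    \<Rightarrow> bool" where
  "left_adjoint C D F G \<longleftrightarrow> is_functor C D F \<and> is_functor D C G \<and>
    (\<exists>\<phi>. (\<forall>X \<in> Obj C. \<forall>Y \<in> Obj D.
            bij_betw (\<phi> X Y) (Hom D (ObMap F X) Y) (Hom C X (ObMap G Y))) \<and>
         (\<forall>X' \<in> Obj C. \<forall>X \<in> Obj C. \<forall>Y \<in> Obj D. \<forall>f \<in> Hom C X' X. \<forall>h \<in> Hom D (ObMap F X) Y.
            \<phi> X' Y (Comp D (ObMap F X') (ObMap F X) Y h (ArMap F X' X f))
            = Comp C X' X (ObMap G Y) (\<phi> X Y h) f) \<and>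
         (\<forall>X \<in> Obj C. \<forall>Y \<in> Obj D. \<forall>Y' \<in> Obj D. \<forall>h \<in> Hom D (ObMap F X) Y. \<forall>g \<in> Hom D Y Y'.
            \<phi> X Y' (Comp D (ObMap F X) Y Y' g h)
            = Comp C X (ObMap G Y) (ObMap G Y') (ArMap G Y Y' g) (\<phi> X Y h)))"

definition full_subcategory :: "('o, 'm) cat \<Rightarrow> 'o set \<Rightarrow> ('o, 'm) cat" where
  "full_subcategory C S = C\<lparr>Obj := Obj C \<inter> S\<rparr>"

definition inclusion_functor :: "('o, 'm, 'o, 'm) functor_data" where
  "inclusion_functor = id_functor"

definition final_object :: "('o, 'm) cat \<Rightarrow> 'o \<Rightarrow> bool" where
  "final_object C Z \<longleftrightarrow> Z \<in> Obj C \<and> (\<forall>X \<in> Obj C. \<exists>!f. f \<in> Hom C X Z)"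


section \<open>Monads, Kleisli categories, order enrichment\<close>

locale monad = T: is_functor C C T
    + mult: natural_transformation C C "comp_functor T T" T mu
    + unit: natural_transformation C C id_functor T eta
  for C :: "('o, 'm) cat" and T :: "('o, 'm, 'o, 'm) functor_data"
    and mu :: "'o \<Rightarrow> 'm" and eta :: "'o \<Rightarrow> 'm" +
  assumes mult_assoc: "X \<in> Obj C \<Longrightarrow>
      Comp C (ObMap T (ObMap T (ObMap T X))) (ObMap T (ObMap T X)) (ObMap T X)
        (mu X) (ArMap T (ObMap T (ObMap T X)) (ObMap T X) (mu X))
      = Comp C (ObMap T (ObMap T (ObMap T X))) (ObMap T (ObMap T X)) (ObMap T X)
        (mu X) (mu (ObMap T X))"
    and mult_unit_left: "X \<in> Obj C \<Longrightarrow>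
      Comp C (ObMap T X) (ObMap T (ObMap T X)) (ObMap T X) (mu X) (eta (ObMap T X))
      = Ident C (ObMap T X)"
    and mult_unit_right: "X \<in> Obj C \<Longrightarrow>
      Comp C (ObMap T X) (ObMap T (ObMap T X)) (ObMap T X) (mu X) (ArMap T X (ObMap T X) (eta X))
      = Ident C (ObMap T X)"

definition Kleisli ::
  "('o, 'm) cat \<Rightarrow> ('o, 'm, 'o, 'm) functor_data \<Rightarrow> ('o \<Rightarrow> 'm) \<Rightarrow> ('o \<Rightarrow> 'm) \<Rightarrow> ('o, 'm) cat" where
  "Kleisli C T mu eta = \<lparr>Obj = Obj C,
     Hom = (\<lambda>X Y. Hom C X (ObMap T Y)),
     Comp = (\<lambda>X Y Z g f.
       Comp C X (ObMap T (ObMap T Z)) (ObMap T Z) (mu Z)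
         (Comp C X (ObMap T Y) (ObMap T (ObMap T Z)) (ArMap T Y (ObMap T Z) g) f)),
     Ident = eta\<rparr>"

locale order_enriched = category K
  for K :: "('o, 'm) cat" +
  fixes le :: "'o \<Rightarrow> 'o \<Rightarrow> 'm rel"
  assumes Hom_poset: "\<lbrakk>X \<in> Obj K; Y \<in> Obj K\<rbrakk> \<Longrightarrow> partial_order_on (Hom K X Y) (le X Y)"
    and Comp_mono: "\<lbrakk>X \<in> Obj K; Y \<in> Obj K; Z \<in> Obj K; (f, f') \<in> le X Y; (g, g') \<in> le Y Z\<rbrakk>
      \<Longrightarrow> (Comp K X Y Z g f, Comp K X Y Z g' f') \<in> le X Z"


section \<open>Categories of coalgebras\<close>

text \<open>A coalgebra is represented by its carrier together with its structure morphism.\<close>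

definition coalgebras :: "('o, 'm) cat \<Rightarrow> ('o, 'm, 'o, 'm) functor_data \<Rightarrow> ('o \<times> 'm) set" where
  "coalgebras C T = {(X, \<alpha>). X \<in> Obj C \<and> \<alpha> \<in> Hom C X (ObMap T X)}"

definition coalg_cat ::
  "('o, 'm) cat \<Rightarrow> ('o, 'm, 'o, 'm) functor_data \<Rightarrow> ('o \<times> 'm, 'm) cat" where
  "coalg_cat C T = \<lparr>Obj = coalgebras C T,
     Hom = (\<lambda>(X, \<alpha>) (Y, \<beta>). {f \<in> Hom C X Y.
       Comp C X (ObMap T X) (ObMap T Y) (ArMap T X Y f) \<alpha> = Comp C X Y (ObMap T Y) \<beta> f}),
     Comp = (\<lambda>a b c. Comp C (fst a) (fst b) (fst c)),
     Ident = (\<lambda>a. Ident C (fst a))\<rparr>"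

text \<open>
  The relation \<open>le X Y\<close> is the order on the Kleisli hom-set from \<open>X\<close> to \<open>Y\<close>,
  i.e. on the morphisms from \<open>X\<close> to \<open>ObMap T Y\<close> in the base category.
\<close>

definition lax_coalg_cat ::
  "('o, 'm) cat \<Rightarrow> ('o, 'm, 'o, 'm) functor_data \<Rightarrow> ('o \<Rightarrow> 'o \<Rightarrow> 'm rel) \<Rightarrow> ('o \<times> 'm, 'm) cat" where
  "lax_coalg_cat C T le = \<lparr>Obj = coalgebras C T,
     Hom = (\<lambda>(X, \<alpha>) (Y, \<beta>). {f \<in> Hom C X Y.
       (Comp C X (ObMap T X) (ObMap T Y) (ArMap T X Y f) \<alpha>, Comp C X Y (ObMap T Y) \<beta> f)
         \<in> le X Y}),
     Comp = (\<lambda>a b c. Comp C (fst a) (fst b) (fst c)),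
     Ident = (\<lambda>a. Ident C (fst a))\<rparr>"

definition refl_trans_coalgebras ::
  "('o, 'm) cat \<Rightarrow> ('o, 'm, 'o, 'm) functor_data \<Rightarrow> ('o \<Rightarrow> 'm) \<Rightarrow> ('o \<Rightarrow> 'm)
    \<Rightarrow> ('o \<Rightarrow> 'o \<Rightarrow> 'm rel) \<Rightarrow> ('o \<times> 'm) set" where
  "refl_trans_coalgebras C T mu eta le = {(X, \<alpha>) \<in> coalgebras C T.
     (Ident (Kleisli C T mu eta) X, \<alpha>) \<in> le X X \<and>
     (Comp (Kleisli C T mu eta) X X X \<alpha> \<alpha>, \<alpha>) \<in> le X X}"

definition star_lax_coalg_cat ::
  "('o, 'm) cat \<Rightarrow> ('o, 'm, 'o, 'm) functor_data \<Rightarrow> ('o \<Rightarrow> 'm) \<Rightarrow> ('o \<Rightarrow> 'm)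
    \<Rightarrow> ('o \<Rightarrow> 'o \<Rightarrow> 'm rel) \<Rightarrow> ('o \<times> 'm, 'm) cat" where
  "star_lax_coalg_cat C T mu eta le =
     full_subcategory (lax_coalg_cat C T le) (refl_trans_coalgebras C T mu eta le)"

definition star_coalg_cat ::
  "('o, 'm) cat \<Rightarrow> ('o, 'm, 'o, 'm) functor_data \<Rightarrow> ('o \<Rightarrow> 'm) \<Rightarrow> ('o \<Rightarrow> 'm)
    \<Rightarrow> ('o \<Rightarrow> 'o \<Rightarrow> 'm rel) \<Rightarrow> ('o \<times> 'm, 'm) cat" where
  "star_coalg_cat C T mu eta le =
     full_subcategory (coalg_cat C T) (refl_trans_coalgebras C T mu eta le)"

text \<open>
  Here \<open>z\<close> is meant to be a final coalgebra; then the description operator picks the unique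
  homomorphism from \<open>a\<close> to \<open>z\<close>.
\<close>

definition beh ::
  "('o, 'm) cat \<Rightarrow> ('o, 'm, 'o, 'm) functor_data \<Rightarrow> 'o \<times> 'm \<Rightarrow> 'o \<times> 'm \<Rightarrow> 'm" where
  "beh C T z a = (THE f. f \<in> Hom (coalg_cat C T) a z)"

definition wbeh ::
  "('o, 'm) cat \<Rightarrow> ('o, 'm, 'o, 'm) functor_data \<Rightarrow> ('o \<times> 'm, 'm, 'o \<times> 'm, 'm) functor_data
    \<Rightarrow> 'o \<times> 'm \<Rightarrow> 'o \<times> 'm \<Rightarrow> 'm" where
  "wbeh C T star z a = beh C T z (ObMap star a)"


section \<open>Well-definedness\<close>

text \<open>
  The constructions above are categories, so the category axioms contained in
  \<open>order_enriched\<close>, \<open>is_functor\<close> and \<open>left_adjoint\<close> add no assumption when these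
  predicates are applied to them.
\<close>

lemma category_Kleisli: assumes "monad C T mu eta" shows "category (Kleisli C T mu eta)"
proof -
  interpret monad C T mu eta by fact
  note ax = T.dom.Comp_in_Hom T.ObMap_in_Obj T.ArMap_in_Hom
  have mu: "X \<in> Obj C \<Longrightarrow> mu X \<in> Hom C (ObMap T (ObMap T X)) (ObMap T X)" for X
    using mult.component_in_Hom by (simp add: comp_functor_def)
  have eta: "X \<in> Obj C \<Longrightarrow> eta X \<in> Hom C X (ObMap T X)" for X
    using unit.component_in_Hom by (simp add: id_functor_def)
  have mun: "\<lbrakk>X \<in> Obj C; Y \<in> Obj C; f \<in> Hom C X Y\<rbrakk> \<Longrightarrow>
     Comp C (ObMap T (ObMap T X)) (ObMap T (ObMap T Y)) (ObMap T Y) (mu Y) (ArMap T (ObMap T X) (ObMap T Y) (ArMap T X Y f))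
     = Comp C (ObMap T (ObMap T X)) (ObMap T X) (ObMap T Y) (ArMap T X Y f) (mu X)" for X Y f
    using mult.naturality by (simp add: comp_functor_def)
  have etan: "\<lbrakk>X \<in> Obj C; Y \<in> Obj C; f \<in> Hom C X Y\<rbrakk> \<Longrightarrow>
     Comp C X Y (ObMap T Y) (eta Y) f = Comp C X (ObMap T X) (ObMap T Y) (ArMap T X Y f) (eta X)" for X Y f
    using unit.naturality by (simp add: id_functor_def)
  show ?thesis
  proof (unfold_locales, goal_cases)
    case (1 X) then show ?case by (simp add: Kleisli_def eta)
  next case (2 X Y Z f g) then show ?case by (simp add: Kleisli_def ax mu)
  next case (3 X Y f) then show ?case
     by (simp add: Kleisli_def ax mu eta mult_unit_right T.dom.Comp_assoc T.dom.Comp_Ident_left)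
  next case (4 X Y f) then show ?case
     apply (simp add: Kleisli_def)
     apply (subst etan[symmetric]) 
     apply (simp_all add: ax mu eta mult_unit_left T.dom.Comp_assoc T.dom.Comp_Ident_left)
     done
  next case (5 W X Y Z f g h)
     then have O: "W \<in> Obj C" "X \<in> Obj C" "Y \<in> Obj C" "Z \<in> Obj C"
      and f: "f \<in> Hom C W (ObMap T X)" and g: "g \<in> Hom C X (ObMap T Y)" and h: "h \<in> Hom C Y (ObMap T Z)"
      by (simp_all add: Kleisli_def)
     let ?T = "ObMap T" and ?t = "ArMap T"
     have A: "Comp C (?T (?T Y)) (?T(?T(?T Z))) (?T(?T Z)) (mu (?T Z)) (?t (?T Y) (?T(?T Z)) (?t Y (?T Z) h))
        = Comp C (?T (?T Y)) (?T Y) (?T(?T Z)) (?t Y (?T Z) h) (mu Y)"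
       using mun O h ax by simp
     show ?case using O f g h
       apply (simp add: Kleisli_def)
       apply (simp add: T.ArMap_Comp ax mu)
       apply (simp add: T.dom.Comp_assoc ax mu)
       apply (simp add: mult_assoc)
       apply (simp flip: T.dom.Comp_assoc add: ax mu)
       apply (simp add: T.dom.Comp_assoc[of W "?T(?T Y)" "?T(?T(?T Z))" "?T(?T Z)"] ax mu A)
       apply (simp flip: T.dom.Comp_assoc add: ax mu)
       done
  qed
qed

lemma category_coalg_cat: assumes "monad C T mu eta" shows "category (coalg_cat C T)"
proof -
  interpret monad C T mu eta by fact
  note ax = T.dom.Comp_in_Hom T.ObMap_in_Obj T.ArMap_in_Hom
  show ?thesis
  proof (unfold_locales, goal_cases)
    case (1 X) then show ?case by (auto simp: coalg_cat_def coalgebras_def T.dom.Ident_in_Hom T.ArMap_Ident T.dom.Comp_Ident_left T.dom.Comp_Ident_right ax)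
  next case (2 X Y Z f g) 
    then show ?case 
      apply (auto simp: coalg_cat_def coalgebras_def ax T.ArMap_Comp)
      apply (simp flip: T.dom.Comp_assoc add: ax)
      apply (simp add: T.dom.Comp_assoc ax)
      done
  next case 3 then show ?case by (auto simp: coalg_cat_def coalgebras_def T.dom.Comp_Ident_left)
  next case 4 then show ?case by (auto simp: coalg_cat_def coalgebras_def T.dom.Comp_Ident_right)
  next case 5 then show ?case by (auto simp: coalg_cat_def coalgebras_def T.dom.Comp_assoc)
  qed
qed

lemma category_lax_coalg_cat: assumes "monad C T mu eta" "order_enriched (Kleisli C T mu eta) le" 
  shows "category (lax_coalg_cat C T le)"
proof -
  interpret monad C T mu eta by fact
  interpret K: order_enriched "Kleisli C T mu eta" le by fact
  note ax = T.dom.Comp_in_Hom T.ObMap_in_Obj T.ArMap_in_Hom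
  have mu: "X \<in> Obj C \<Longrightarrow> mu X \<in> Hom C (ObMap T (ObMap T X)) (ObMap T X)" for X
    using mult.component_in_Hom by (simp add: comp_functor_def)
  have eta: "X \<in> Obj C \<Longrightarrow> eta X \<in> Hom C X (ObMap T X)" for X
    using unit.component_in_Hom by (simp add: id_functor_def)
  have etan: "\<lbrakk>X \<in> Obj C; Y \<in> Obj C; f \<in> Hom C X Y\<rbrakk> \<Longrightarrow>
     Comp C X Y (ObMap T Y) (eta Y) f = Comp C X (ObMap T X) (ObMap T Y) (ArMap T X Y f) (eta X)" for X Y f
    using unit.naturality by (simp add: id_functor_def)
  have refl: "(f,f) \<in> le X Y" if "X \<in> Obj C" "Y \<in> Obj C" "f \<in> Hom C X (ObMap T Y)" for X Y f
    using K.Hom_poset[of X Y] that by (auto simp: Kleisli_def partial_order_on_def preorder_on_def refl_on_def)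
  have tr: "(f,h) \<in> le X Y" if "X \<in> Obj C" "Y \<in> Obj C" "(f,g) \<in> le X Y" "(g,h) \<in> le X Y" for X Y f g h
    using K.Hom_poset[of X Y] that by (auto simp: Kleisli_def partial_order_on_def preorder_on_def dest: transD)
  have le1: "f \<in> Hom C X (ObMap T Y) \<and> g \<in> Hom C X (ObMap T Y)" if "X \<in> Obj C" "Y \<in> Obj C" "(f,g) \<in> le X Y" for X Y f g
    using K.Hom_poset[of X Y] that by (auto simp: Kleisli_def partial_order_on_def preorder_on_def)
  have pre: "(Comp C X Y (ObMap T Z) g f, Comp C X Y (ObMap T Z) g' f) \<in> le X Z"
    if "X \<in> Obj C" "Y \<in> Obj C" "Z \<in> Obj C" "f \<in> Hom C X Y" "(g,g') \<in> le Y Z" for X Y Z f g g'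
  proof -
    let ?f = "Comp C X Y (ObMap T Y) (eta Y) f"
    have *: "Comp (Kleisli C T mu eta) X Y Z g ?f = Comp C X Y (ObMap T Z) g f" if g: "g \<in> Hom C Y (ObMap T Z)" for g
    proof -
      have "Comp (Kleisli C T mu eta) X Y Z g ?f = Comp C X Y (ObMap T Z) (Comp (Kleisli C T mu eta) Y Y Z g (eta Y)) f"
        using \<open>X \<in> _\<close> \<open>Y \<in> _\<close> \<open>Z \<in> _\<close> g \<open>f \<in> _\<close> by (simp add: Kleisli_def T.dom.Comp_assoc ax mu eta)
      then show ?thesis using K.Comp_Ident_right[of Y Z g] g that by (simp add: Kleisli_def \<open>Y \<in> _\<close> \<open>Z \<in> _\<close>)
    qed
    have "(Comp (Kleisli C T mu eta) X Y Z g ?f, Comp (Kleisli C T mu eta) X Y Z g' ?f) \<in> le X Z"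
      by (rule K.Comp_mono) (use that refl ax eta in \<open>auto simp: Kleisli_def\<close>)
    then show ?thesis using * le1 that by metis
  qed
  have post: "(Comp C X (ObMap T Y) (ObMap T Z) (ArMap T Y Z g) a, Comp C X (ObMap T Y) (ObMap T Z) (ArMap T Y Z g) b) \<in> le X Z"
    if "X \<in> Obj C" "Y \<in> Obj C" "Z \<in> Obj C" "g \<in> Hom C Y Z" "(a,b) \<in> le X Y" for X Y Z g a b
  proof -
    let ?g = "Comp C Y Z (ObMap T Z) (eta Z) g"
    have *: "Comp (Kleisli C T mu eta) X Y Z ?g a = Comp C X (ObMap T Y) (ObMap T Z) (ArMap T Y Z g) a" if "a \<in> Hom C X (ObMap T Y)" for a
      using that \<open>X \<in> _\<close> \<open>Y \<in> _\<close> \<open>Z \<in> _\<close> \<open>g \<in> _\<close>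
      by (simp add: Kleisli_def T.ArMap_Comp T.dom.Comp_assoc ax mu eta mult_unit_right T.dom.Comp_Ident_left)
    have "(Comp (Kleisli C T mu eta) X Y Z ?g a, Comp (Kleisli C T mu eta) X Y Z ?g b) \<in> le X Z"
      by (rule K.Comp_mono) (use that refl ax eta in \<open>auto simp: Kleisli_def\<close>)
    then show ?thesis using * le1 that by metis
  qed
  show ?thesis
  proof (unfold_locales, goal_cases)
    case (1 X) then show ?case by (auto simp: lax_coalg_cat_def coalgebras_def T.dom.Ident_in_Hom T.ArMap_Ident T.dom.Comp_Ident_left T.dom.Comp_Ident_right ax refl)
  next case (2 a b c f g) 
    obtain X \<alpha> Y \<beta> Z \<gamma> where abc: "a = (X,\<alpha>)" "b = (Y,\<beta>)" "c = (Z,\<gamma>)" by (metis surj_pair)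
    have h: "X \<in> Obj C" "Y \<in> Obj C" "Z \<in> Obj C" "f \<in> Hom C X Y" "g \<in> Hom C Y Z" 
       "\<alpha> \<in> Hom C X (ObMap T X)" "\<beta> \<in> Hom C Y (ObMap T Y)" "\<gamma> \<in> Hom C Z (ObMap T Z)"
      and l1: "(Comp C X (ObMap T X) (ObMap T Y) (ArMap T X Y f) \<alpha>, Comp C X Y (ObMap T Y) \<beta> f) \<in> le X Y"
      and l2: "(Comp C Y (ObMap T Y) (ObMap T Z) (ArMap T Y Z g) \<beta>, Comp C Y Z (ObMap T Z) \<gamma> g) \<in> le Y Z"
      using 2 by (auto simp: abc lax_coalg_cat_def coalgebras_def)
    have "(Comp C X (ObMap T X) (ObMap T Z) (ArMap T X Z (Comp C X Y Z g f)) \<alpha>, Comp C X Z (ObMap T Z) \<gamma> (Comp C X Y Z g f)) \<in> le X Z"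
      using tr[OF h(1,3), of _ _ "Comp C X Y (ObMap T Z) (Comp C Y Z (ObMap T Z) \<gamma> g) f"] post[OF h(1-3,5) l1] pre[OF h(1-3,4) l2] h
      by (simp add: ax T.ArMap_Comp T.dom.Comp_assoc)
    then show ?case using h by (simp add: abc lax_coalg_cat_def ax)
  next case 3 then show ?case by (auto simp: lax_coalg_cat_def coalgebras_def T.dom.Comp_Ident_left)
  next case 4 then show ?case by (auto simp: lax_coalg_cat_def coalgebras_def T.dom.Comp_Ident_right)
  next case 5 then show ?case by (auto simp: lax_coalg_cat_def coalgebras_def T.dom.Comp_assoc)
  qed
qed

lemma category_full_subcategory: "category C \<Longrightarrow> category (full_subcategory C S)"
  by (simp add: category_def full_subcategory_def)

lemma is_functor_inclusion: 
  "category C \<Longrightarrow> is_functor (full_subcategory C S) C inclusion_functor"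
  by (simp add: category_full_subcategory is_functor_def is_functor_axioms_def inclusion_functor_def id_functor_def) (simp add: full_subcategory_def)

end

theory Submission
  imports Defs
begin

text \<open>
  The homomorphism \<open>beh \<alpha>\<close> from \<open>\<alpha>\<close> to \<open>\<zeta>\<close> is, as the same morphism of the base
  category, also a homomorphism from \<open>\<alpha>\<^sup>*\<close> to \<open>\<zeta>\<^sup>*\<close>. Followed by the homomorphism
  \<open>beh \<zeta>\<^sup>*\<close> it is a homomorphism from \<open>\<alpha>\<^sup>*\<close> to \<open>\<zeta>\<close>, which by finality is
  \<open>beh \<alpha>\<^sup>*\<close>.
\<close>

text \<open>The two sides of the homomorphism equation are the same element of a Kleisli hom-set, so
  reflexivity of its order suffices. This gives access to \<open>star_morphism\<close>, which speaks
  of lax homomorphisms only.\<close>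

lemma Hom_coalg_cat_subset_Hom_lax_coalg_cat:
  assumes "monad C T mu eta" and "order_enriched (Kleisli C T mu eta) le"
    and "a \<in> coalgebras C T" and "b \<in> coalgebras C T"
  shows "Hom (coalg_cat C T) a b \<subseteq> Hom (lax_coalg_cat C T le) a b"
proof
  fix f assume f: "f \<in> Hom (coalg_cat C T) a b"
  interpret monad C T mu eta by fact
  interpret K: order_enriched "Kleisli C T mu eta" le by fact
  obtain X \<alpha> Y \<beta> where ab: "a = (X, \<alpha>)" "b = (Y, \<beta>)"
    by (metis surj_pair)
  have XY: "X \<in> Obj C" "Y \<in> Obj C" and \<beta>: "\<beta> \<in> Hom C Y (ObMap T Y)"
    using assms(3,4) by (auto simp: ab coalgebras_def)
  have fXY: "f \<in> Hom C X Y"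
    and eq: "Comp C X (ObMap T X) (ObMap T Y) (ArMap T X Y f) \<alpha> = Comp C X Y (ObMap T Y) \<beta> f"
    using f by (auto simp: ab coalg_cat_def)
  have "Comp C X Y (ObMap T Y) \<beta> f \<in> Hom C X (ObMap T Y)"
    by (rule T.dom.Comp_in_Hom) (use XY fXY \<beta> T.ObMap_in_Obj in simp_all)
  \<comment> \<open>Kleisli morphisms from \<open>X\<close> to \<open>Y\<close> are the base
    morphisms from \<open>X\<close> to \<open>ObMap T Y\<close>.\<close>
  moreover have "partial_order_on (Hom C X (ObMap T Y)) (le X Y)"
    using K.Hom_poset[of X Y] XY by (simp add: Kleisli_def)
  ultimately have "(Comp C X Y (ObMap T Y) \<beta> f, Comp C X Y (ObMap T Y) \<beta> f) \<in> le X Y"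
    by (auto simp: partial_order_on_def preorder_on_def refl_on_def)
  with fXY eq show "f \<in> Hom (lax_coalg_cat C T le) a b"
    by (simp add: ab lax_coalg_cat_def)
qed

lemma beh_in_Hom:
  assumes "final_object (coalg_cat C T) z" and "a \<in> Obj (coalg_cat C T)"
  shows "beh C T z a \<in> Hom (coalg_cat C T) a z"
  unfolding beh_def by (rule theI') (use assms in \<open>simp add: final_object_def\<close>)

lemma beh_eqI:
  assumes "final_object (coalg_cat C T) z" and "a \<in> Obj (coalg_cat C T)"
    and "f \<in> Hom (coalg_cat C T) a z"
  shows "beh C T z a = f"
  unfolding beh_def by (rule the1_equality) (use assms in \<open>simp_all add: final_object_def\<close>)

theorem theorem7p2:
  fixes C :: "('o, 'm) cat"
    and T :: "('o, 'm, 'o, 'm) functor_data"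
    and mu eta :: "'o \<Rightarrow> 'm"
    and le :: "'o \<Rightarrow> 'o \<Rightarrow> 'm rel"
    and star :: "('o \<times> 'm, 'm, 'o \<times> 'm, 'm) functor_data"
    and Z :: 'o and \<zeta> :: 'm
  assumes monad: "monad C T mu eta"
    and enriched: "order_enriched (Kleisli C T mu eta) le"
    and adjoint: "left_adjoint (lax_coalg_cat C T le) (star_lax_coalg_cat C T mu eta le)
      star inclusion_functor"
    and restricts: "is_functor (coalg_cat C T) (star_coalg_cat C T mu eta le) star"
    and star_carrier: "\<And>X \<alpha>. (X, \<alpha>) \<in> Obj (lax_coalg_cat C T le)
      \<Longrightarrow> fst (ObMap star (X, \<alpha>)) = X"
    and star_morphism: "\<And>a b f. \<lbrakk>a \<in> Obj (lax_coalg_cat C T le); b \<in> Obj (lax_coalg_cat C T le);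
        f \<in> Hom (lax_coalg_cat C T le) a b\<rbrakk> \<Longrightarrow> ArMap star a b f = f"
    and final: "final_object (coalg_cat C T) (Z, \<zeta>)"
  shows "\<forall>X \<alpha>. X \<in> Obj C \<and> \<alpha> \<in> Hom C X (ObMap T X) \<longrightarrow>
    wbeh C T star (Z, \<zeta>) (X, \<alpha>) = beh C T (Z, \<zeta>) (ObMap star (X, \<alpha>)) \<and>
    beh C T (Z, \<zeta>) (ObMap star (X, \<alpha>))
      = Comp C X Z Z (beh C T (Z, \<zeta>) (ObMap star (Z, \<zeta>))) (beh C T (Z, \<zeta>) (X, \<alpha>)) \<and>
    Comp C X Z Z (beh C T (Z, \<zeta>) (ObMap star (Z, \<zeta>))) (beh C T (Z, \<zeta>) (X, \<alpha>))
      = Comp C X Z Z (wbeh C T star (Z, \<zeta>) (Z, \<zeta>)) (beh C T (Z, \<zeta>) (X, \<alpha>))"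
proof (intro allI impI)
  fix X \<alpha> assume "X \<in> Obj C \<and> \<alpha> \<in> Hom C X (ObMap T X)"
  let ?A = "coalg_cat C T" and ?z = "(Z, \<zeta>)" and ?a = "(X, \<alpha>)"
  interpret A: category ?A
    using monad by (rule category_coalg_cat)
  interpret S: is_functor ?A "star_coalg_cat C T mu eta le" star
    by (rule restricts)
  have Obj_lax: "Obj (lax_coalg_cat C T le) = Obj ?A"
    by (simp add: lax_coalg_cat_def coalg_cat_def)
  have Obj_A: "Obj ?A = coalgebras C T"
    by (simp add: coalg_cat_def)
  have a: "?a \<in> Obj ?A"
    using \<open>X \<in> Obj C \<and> \<alpha> \<in> Hom C X (ObMap T X)\<close> by (simp add: Obj_A coalgebras_def)
  have z: "?z \<in> Obj ?A"
    using final by (simp add: final_object_def)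
  \<comment> \<open>Needed so that finality applies to the starred coalgebras as well.\<close>
  have star_Obj: "ObMap star b \<in> Obj ?A" if "b \<in> Obj ?A" for b
    using S.ObMap_in_Obj[OF that] by (simp add: star_coalg_cat_def full_subcategory_def)
  let ?f = "beh C T ?z ?a" and ?g = "beh C T ?z (ObMap star ?z)"
  have f: "?f \<in> Hom ?A ?a ?z"
    using final a by (rule beh_in_Hom)
  then have "?f \<in> Hom (lax_coalg_cat C T le) ?a ?z"
    using Hom_coalg_cat_subset_Hom_lax_coalg_cat[OF monad enriched, of ?a ?z] a z
    by (simp add: Obj_A subset_iff)
  then have "ArMap star ?a ?z ?f = ?f"
    using star_morphism a z by (simp add: Obj_lax)
  \<comment> \<open>\<open>restricts\<close> makes the image of \<open>?f\<close> a strict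
    homomorphism in the full subcategory, whose hom-sets are those of \<open>?A\<close>; the image
    is \<open>?f\<close> itself.\<close>
  then have "?f \<in> Hom ?A (ObMap star ?a) (ObMap star ?z)"
    using S.ArMap_in_Hom[OF a z f] by (simp add: star_coalg_cat_def full_subcategory_def)
  moreover have "?g \<in> Hom ?A (ObMap star ?z) ?z"
    using final star_Obj[OF z] by (rule beh_in_Hom)
  ultimately have "Comp ?A (ObMap star ?a) (ObMap star ?z) ?z ?g ?f \<in> Hom ?A (ObMap star ?a) ?z"
    using star_Obj a z by (intro A.Comp_in_Hom) simp_all
  \<comment> \<open>Composition in \<open>?A\<close> depends on the coalgebras only through their
    carriers, which \<open>star\<close> keeps; so the composite is the one in \<open>C\<close> at
    \<open>X\<close>, \<open>Z\<close>, \<open>Z\<close>.\<close>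
  moreover have "fst (ObMap star ?a) = X" "fst (ObMap star ?z) = Z"
    using star_carrier a z by (simp_all add: Obj_lax)
  then have "Comp ?A (ObMap star ?a) (ObMap star ?z) ?z ?g ?f = Comp C X Z Z ?g ?f"
    by (simp add: coalg_cat_def)
  ultimately have "beh C T ?z (ObMap star ?a) = Comp C X Z Z ?g ?f"
    using beh_eqI[OF final star_Obj[OF a]] by simp
  \<comment> \<open>The two outer equations hold by definition of \<open>wbeh\<close>.\<close>
  then show "wbeh C T star ?z ?a = beh C T ?z (ObMap star ?a) \<and>
    beh C T ?z (ObMap star ?a) = Comp C X Z Z ?g ?f \<and>
    Comp C X Z Z ?g ?f = Comp C X Z Z (wbeh C T star ?z ?z) ?f"
    by (simp add: wbeh_def)
qed

end
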